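(* For almost all graphs $G=(V,E)$ the following holds: for every weight function $w:E\to\mathbb{R}_{\ge 0}$ and every positive integer $k$ with $\Delta(G)\le k$, the weighted graph $(V,E,w)$ has a bisection of weight at least $\frac{k+1}{2k}w(G)$ if $k$ is odd, and at least $\frac{k+2}{2(k+1)}w(G)$ if $k$ is even. Here "almost all" means that the proportion of graphs on the vertex set $\{1,\dots,n\}$, among all $2^{\binom n2}$ such graphs, that have this property tends to $1$ as $n\to\infty$.
   Context: Graphs are finite and simple; $\Delta(G)$ is the maximum degree. For a weight function $w:E\to\mathbb{R}_{\ge 0}$, $w(G)=\sum_{e\in E}w(e)$. A bisection of $G$ is a partition $(X,Y)$ of $V$ with $\big||X|-|Y|\big|\le 1$, and its weight is the total weight of the edges with one endpoint in $X$ and the other in $Y$. *)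

theory Defs
  imports "HOL-Analysis.Analysis" "HOL-Library.Ramsey"
begin

text \<open>
  A finite simple graph is given by a finite vertex set \<open>V\<close> and an edge set \<open>E\<close> of
  two-element subsets of \<open>V\<close>; \<open>nsets V 2\<close> is the set of all such subsets.
\<close>

definition simple_graph :: "'a set \<Rightarrow> 'a set set \<Rightarrow> bool" where
  "simple_graph V E \<longleftrightarrow> finite V \<and> E \<subseteq> nsets V 2"

definition degree :: "'a set set \<Rightarrow> 'a \<Rightarrow> nat" where
  "degree E v = card {e \<in> E. v \<in> e}"

text \<open>The inserted \<open>0\<close> matters only for the graph without vertices.\<close>

definition max_degree :: "'a set \<Rightarrow> 'a set set \<Rightarrow> nat" where
  "max_degree V E = Max (insert 0 (degree E ` V))"

text \<open>
  Weight functions are total functions on vertex sets, of which only the values on \<open>E\<close>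
  are constrained or used.
\<close>

definition weight_function :: "'a set set \<Rightarrow> ('a set \<Rightarrow> real) \<Rightarrow> bool" where
  "weight_function E w \<longleftrightarrow> (\<forall>e\<in>E. 0 \<le> w e)"

definition total_weight :: "'a set set \<Rightarrow> ('a set \<Rightarrow> real) \<Rightarrow> real" where
  "total_weight E w = (\<Sum>e\<in>E. w e)"

definition bisection :: "'a set \<Rightarrow> 'a set \<Rightarrow> 'a set \<Rightarrow> bool" where
  "bisection V X Y \<longleftrightarrow>
     X \<union> Y = V \<and> X \<inter> Y = {} \<and> \<bar>int (card X) - int (card Y)\<bar> \<le> 1"

definition cut_edges :: "'a set set \<Rightarrow> 'a set \<Rightarrow> 'a set \<Rightarrow> 'a set set" where
  "cut_edges E X Y = {e \<in> E. \<exists>x\<in>X. \<exists>y\<in>Y. e = {x, y}}"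

definition cut_weight :: "'a set set \<Rightarrow> ('a set \<Rightarrow> real) \<Rightarrow> 'a set \<Rightarrow> 'a set \<Rightarrow> real" where
  "cut_weight E w X Y = (\<Sum>e\<in>cut_edges E X Y. w e)"

definition almost_all_graphs :: "(nat set \<Rightarrow> nat set set \<Rightarrow> bool) \<Rightarrow> bool" where
  "almost_all_graphs P \<longleftrightarrow>
     (\<lambda>n. real (card {E. simple_graph {1..n} E \<and> P {1..n} E}) /
          real (card {E. simple_graph {1..n} E})) \<longlonglongrightarrow> 1"

lemma card_simple_graphs:
  "card {E. simple_graph {1..n} E} = 2 ^ (n choose 2)" for n :: nat
proof -
  have "{E. simple_graph {1..n} E} = Pow (nsets {1..n} 2)"
    by (auto simp: simple_graph_def)
  moreover have "finite (nsets {1..n} 2)"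
    by (simp add: finite_imp_finite_nsets)
  moreover have "card (nsets {1..n} 2) = n choose 2"
    by (simp add: card_nsets)
  ultimately show ?thesis by (simp add: card_Pow)
qed

end

theory Submission
  imports Defs "HOL-Library.Discrete_Functions" "HOL-Real_Asymp.Real_Asymp"
begin

text \<open>
  Suppose that the vertices can be grouped into \<open>c\<close> non-adjacent pairs, and let \<open>d\<close> be the odd
  one of \<open>c - 1\<close> and \<open>c\<close>. A round-robin tournament with \<open>d\<close> rounds lets every two pairs meet
  once, so in some round the edges between opponents carry at least \<open>1/d\<close> of the total weight.
  Put opponents on opposite sides, split a pair without opponent, and orient each match at random:
  the edges of that round are all cut and every other edge is cut with probability \<open>1/2\<close>, which
  gives a bisection of weight at least \<open>(1/2 + 1/(2d)) w(G)\<close>. For odd \<open>n\<close>, an isolated dummy vertex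
  is added first.

  Such pairs exist for almost all graphs: a graph without a biclique of type
  \<open>(1, n - 2q)\<close> or \<open>(q, q)\<close> has this property by an augmenting path argument in the complement, and
  for \<open>q\<close> about \<open>sqrt n\<close> almost all graphs have no such biclique by the union bound. Finally
  \<open>c \<le> \<Delta>(G) + 1\<close> for almost all graphs: among \<open>s\<close> fixed vertices, the neighbourhoods in the
  remaining vertices are independent and each reaches size \<open>n div 2\<close> with probability at least
  \<open>1/4\<close>, so all degrees are below \<open>n div 2\<close> with probability at most \<open>(3/4)^s\<close>.
\<close>

section \<open>Cuts from a perfect matching of the complement\<close>

lemma card_fixpoint_free_involution:
  assumes "finite W" "\<And>v. v \<in> W \<Longrightarrow> \<mu> v \<in> W"
    and "\<And>v. v \<in> W \<Longrightarrow> \<mu> (\<mu> v) = v" "\<And>v. v \<in> W \<Longrightarrow> \<mu> v \<noteq> v"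
  shows "card W = 2 * card ((\<lambda>v. {v, \<mu> v}) ` W)"
proof -
  let ?C = "(\<lambda>v. {v, \<mu> v}) ` W"
  have U: "\<Union> ?C = W" using assms(2) by auto
  have "2 * card ?C = card (\<Union> ?C)"
  proof (rule card_partition)
    show "finite ?C" "finite (\<Union> ?C)" using assms(1) U by auto
    show "card c = 2" if "c \<in> ?C" for c
      using that assms(4) by (auto simp: card_2_iff)
    show "c1 \<inter> c2 = {}" if "c1 \<in> ?C" "c2 \<in> ?C" "c1 \<noteq> c2" for c1 c2
    proof (rule ccontr)
      assume "c1 \<inter> c2 \<noteq> {}"
      moreover obtain u v where "u \<in> W" "v \<in> W" "c1 = {u, \<mu> u}" "c2 = {v, \<mu> v}"
        using \<open>c1 \<in> ?C\<close> \<open>c2 \<in> ?C\<close> by auto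
      moreover have "\<mu> u = \<mu> v \<longleftrightarrow> u = v"
        using assms(3)[OF \<open>u \<in> W\<close>] assms(3)[OF \<open>v \<in> W\<close>] by metis
      ultimately have "u = v \<or> u = \<mu> v" using assms(3) by auto
      then show False
        using \<open>c1 \<noteq> c2\<close> \<open>v \<in> W\<close> \<open>c1 = _\<close> \<open>c2 = _\<close> assms(3) by (auto simp: insert_commute)
    qed
  qed
  then show ?thesis using U by simp
qed

section \<open>Balanced cuts by averaging over orientations of blocks\<close>

lemma edge_cases:
  assumes "E \<subseteq> nsets V 2" "e \<in> E"
  obtains u v where "e = {u, v}" "u \<in> V" "v \<in> V" "u \<noteq> v"
proof -
  have "e \<subseteq> V" "card e = 2" using assms by (auto simp: nsets_def)
  then show thesis using that by (metis card_2_iff insert_subset)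
qed

text \<open>Orient every block, that is every fibre of \<open>f\<close>, independently at random.
  Since \<open>\<psi>\<close> preserves the blocks and flips \<open>s\<close>, it exchanges the two
  sides, so every outcome is balanced. An edge inside a block is always cut by \<open>sep\<close>,
  and an edge between two blocks is cut in exactly half of the outcomes; some outcome attains the
  average.\<close>

lemma exists_orientation_cut:
  fixes w :: "'a set \<Rightarrow> real" and f :: "'a \<Rightarrow> 'b"
  assumes fin: "finite V" and E: "E \<subseteq> nsets V 2"
    and \<psi>: "\<And>v. v \<in> V \<Longrightarrow> \<psi> v \<in> V" "\<And>v. v \<in> V \<Longrightarrow> \<psi> (\<psi> v) = v"
    and f: "\<And>v. v \<in> V \<Longrightarrow> f (\<psi> v) = f v"
    and s: "\<And>v. v \<in> V \<Longrightarrow> s (\<psi> v) \<longleftrightarrow> \<not> s v"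
    and sep: "\<And>u v. {u, v} \<in> E \<Longrightarrow> f u = f v \<Longrightarrow> s u \<longleftrightarrow> \<not> s v"
  obtains X Y where "X \<union> Y = V" "X \<inter> Y = {}" "card X = card Y"
    "total_weight E w + total_weight {e \<in> E. \<exists>u v. e = {u, v} \<and> f u = f v} w
      \<le> 2 * cut_weight E w X Y"
proof -
  \<comment> \<open>\<open>\<sigma>\<close> is the set of blocks (fibres of \<open>f\<close>) whose two sides are swapped.\<close>
  define K where "K = f ` V"
  define X where "X \<sigma> = {v \<in> V. s v \<noteq> (f v \<in> \<sigma>)}" for \<sigma>
  define Y where "Y \<sigma> = {v \<in> V. s v = (f v \<in> \<sigma>)}" for \<sigma>
  define F where "F = {e \<in> E. \<exists>u v. e = {u, v} \<and> f u = f v}"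
  have finK: "finite K" using fin by (simp add: K_def)
  have "finite (nsets V 2)" using fin by (simp add: finite_imp_finite_nsets)
  then have finE: "finite E" using E finite_subset by blast
  have XY: "X \<sigma> \<union> Y \<sigma> = V" "X \<sigma> \<inter> Y \<sigma> = {}" for \<sigma> by (auto simp: X_def Y_def)
  have card: "card (X \<sigma>) = card (Y \<sigma>)" for \<sigma>
  proof -
    have "bij_betw \<psi> (X \<sigma>) (Y \<sigma>)"
      by (rule bij_betw_byWitness[where f' = \<psi>]) (auto simp: X_def Y_def \<psi> f s)
    then show ?thesis by (rule bij_betw_same_card)
  qed
  have cut: "{u, v} \<in> cut_edges E (X \<sigma>) (Y \<sigma>) \<longleftrightarrow> (s u = s v) \<noteq> ((f u \<in> \<sigma>) = (f v \<in> \<sigma>))"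
    if "{u, v} \<in> E" "u \<in> V" "v \<in> V" for u v \<sigma>
    using that by (auto simp: cut_edges_def X_def Y_def doubleton_eq_iff)
  have count: "2 * card {\<sigma> \<in> Pow K. e \<in> cut_edges E (X \<sigma>) (Y \<sigma>)} = (if e \<in> F then 2 else 1) * 2 ^ card K"
    if e: "e \<in> E" for e
  proof -
    obtain u v where uv: "e = {u, v}" "u \<in> V" "v \<in> V" "u \<noteq> v" using edge_cases[OF E e] .
    let ?C = "{\<sigma> \<in> Pow K. e \<in> cut_edges E (X \<sigma>) (Y \<sigma>)}"
    have C: "?C = {\<sigma> \<in> Pow K. (s u = s v) \<noteq> ((f u \<in> \<sigma>) = (f v \<in> \<sigma>))}"
      using cut[of u v] e uv by auto
    have F: "e \<in> F \<longleftrightarrow> f u = f v"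
      using e by (auto simp: F_def uv doubleton_eq_iff)
    show ?thesis
    proof (cases "f u = f v")
      case True
      then have "?C = Pow K" using sep[of u v] e uv C by auto
      then show ?thesis using True F finK by (simp add: card_Pow)
    next
      case False
      \<comment> \<open>Toggling the block of \<open>u\<close> but not that of \<open>v\<close>
        changes whether the edge is cut, so \<open>t\<close> exchanges the outcomes that cut it with
        those that do not.\<close>
      define t where "t \<sigma> = (if f u \<in> \<sigma> then \<sigma> - {f u} else insert (f u) \<sigma>)" for \<sigma>
      have "f u \<in> K" using uv by (simp add: K_def)
      have "bij_betw t ?C (Pow K - ?C)"
        unfolding C
        by (rule bij_betw_byWitness[where f' = t])
          (use False \<open>f u \<in> K\<close> in \<open>auto simp: t_def\<close>)
      then have "card ?C = card (Pow K - ?C)" by (rule bij_betw_same_card)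
      moreover have "card (Pow K - ?C) = card (Pow K) - card ?C"
        by (rule card_Diff_subset) (use finK in auto)
      moreover have "card ?C \<le> card (Pow K)" by (rule card_mono) (use finK in auto)
      ultimately show ?thesis using F False finK by (simp add: card_Pow)
    qed
  qed
  \<comment> \<open>Double counting of pairs of an outcome and an edge cut by it;
    \<open>count\<close> evaluates the inner sum for each edge.\<close>
  have "(\<Sum>\<sigma>\<in>Pow K. 2 * cut_weight E w (X \<sigma>) (Y \<sigma>))
      = (\<Sum>\<sigma>\<in>Pow K. \<Sum>e\<in>E. 2 * (if e \<in> cut_edges E (X \<sigma>) (Y \<sigma>) then w e else 0))"
  proof (rule sum.cong)
    fix \<sigma>
    have "cut_edges E (X \<sigma>) (Y \<sigma>) \<subseteq> E" by (auto simp: cut_edges_def)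
    then have "cut_weight E w (X \<sigma>) (Y \<sigma>) = (\<Sum>e\<in>E. if e \<in> cut_edges E (X \<sigma>) (Y \<sigma>) then w e else 0)"
      unfolding cut_weight_def using finE by (simp add: sum.If_cases Int_absorb1)
    then show "2 * cut_weight E w (X \<sigma>) (Y \<sigma>)
        = (\<Sum>e\<in>E. 2 * (if e \<in> cut_edges E (X \<sigma>) (Y \<sigma>) then w e else 0))"
      by (simp only: sum_distrib_left)
  qed simp
  also have "\<dots> = (\<Sum>e\<in>E. \<Sum>\<sigma>\<in>Pow K. 2 * (if e \<in> cut_edges E (X \<sigma>) (Y \<sigma>) then w e else 0))"
    by (rule sum.swap)
  also have "\<dots> = (\<Sum>e\<in>E. w e * real (2 * card {\<sigma> \<in> Pow K. e \<in> cut_edges E (X \<sigma>) (Y \<sigma>)}))"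
    using finK by (intro sum.cong refl)
      (simp add: sum_distrib_left[symmetric] sum.If_cases Int_def)
  also have "\<dots> = (\<Sum>e\<in>E. w e * (1 + (if e \<in> F then 1 else 0)) * 2 ^ card K)"
    by (intro sum.cong refl) (subst count, auto)
  also have "\<dots> = (\<Sum>e\<in>E. w e + (if e \<in> F then w e else 0)) * 2 ^ card K"
    by (subst sum_distrib_right) (intro sum.cong, auto)
  also have "(\<Sum>e\<in>E. w e + (if e \<in> F then w e else 0)) = total_weight E w + total_weight F w"
    using finE by (simp add: sum.distrib total_weight_def sum.If_cases F_def Int_def)
  also have "\<dots> * 2 ^ card K = (\<Sum>\<sigma>\<in>Pow K. total_weight E w + total_weight F w)"
    using finK by (simp add: card_Pow)
  finally have eq: "(\<Sum>\<sigma>\<in>Pow K. 2 * cut_weight E w (X \<sigma>) (Y \<sigma>))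
    = (\<Sum>\<sigma>\<in>Pow K. total_weight E w + total_weight F w)" .
  have "\<exists>\<sigma>\<in>Pow K. total_weight E w + total_weight F w \<le> 2 * cut_weight E w (X \<sigma>) (Y \<sigma>)"
  proof (rule ccontr)
    assume "\<not> ?thesis"
    then have "(\<Sum>\<sigma>\<in>Pow K. 2 * cut_weight E w (X \<sigma>) (Y \<sigma>))
        < (\<Sum>\<sigma>\<in>Pow K. total_weight E w + total_weight F w)"
      using finK by (intro sum_strict_mono) (auto simp: not_le)
    then show False using eq by simp
  qed
  then show thesis using that XY card F_def by metis
qed

lemma total_weight_mono:
  assumes "finite E" "F \<subseteq> E" "weight_function E w"
  shows "total_weight F w \<le> total_weight E w"
  unfolding total_weight_def using assms
  by (intro sum_mono2) (auto simp: weight_function_def)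

text \<open>A class is a pair \<open>{v, \<mu> v}\<close> and \<open>\<pi>\<close> assigns
  opponents, a fixed point of \<open>\<pi>\<close> being a class without opponent. The blocks are
  the matches. Since the two vertices of a class are non-adjacent, an edge inside a block joins two
  opposing classes, which are put on opposite sides; this is \<open>sep\<close> in
  \<open>exists_orientation_cut\<close>.\<close>

lemma exists_cut_class_involution:
  fixes \<mu> :: "'a::linorder \<Rightarrow> 'a" and cl :: "'a \<Rightarrow> 'b::linorder"
  assumes fin: "finite V" and E: "E \<subseteq> nsets V 2" and w: "weight_function E w"
    and \<mu>: "\<And>v. v \<in> V \<Longrightarrow> \<mu> v \<in> V" "\<And>v. v \<in> V \<Longrightarrow> \<mu> (\<mu> v) = v" "\<And>v. v \<in> V \<Longrightarrow> \<mu> v \<noteq> v"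
    and \<mu>E: "\<And>v. v \<in> V \<Longrightarrow> {v, \<mu> v} \<notin> E"
    and cl: "\<And>u v. u \<in> V \<Longrightarrow> v \<in> V \<Longrightarrow> cl u = cl v \<longleftrightarrow> u = v \<or> u = \<mu> v"
    and \<pi>: "\<And>i. i \<in> cl ` V \<Longrightarrow> \<pi> i \<in> cl ` V" "\<And>i. i \<in> cl ` V \<Longrightarrow> \<pi> (\<pi> i) = i"
  obtains X Y where "X \<union> Y = V" "X \<inter> Y = {}" "card X = card Y"
    "total_weight E w + total_weight {e \<in> E. \<exists>u v. e = {u, v} \<and> \<pi> (cl u) = cl v} w
      \<le> 2 * cut_weight E w X Y"
proof -
  \<comment> \<open>The linear order serves only to tell the two vertices of a class apart.\<close>
  define bit where "bit v \<longleftrightarrow> v < \<mu> v" for v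
  have bit_\<mu>: "bit (\<mu> v) \<longleftrightarrow> \<not> bit v" if "v \<in> V" for v
    using \<mu>[OF that] by (auto simp: bit_def)
  have cl_\<mu>: "cl (\<mu> v) = cl v" if "v \<in> V" for v
    using cl[of "\<mu> v" v] \<mu> that by auto
  have uniq: "u = v" if "u \<in> V" "v \<in> V" "cl u = cl v" "bit u = bit v" for u v
    using cl[of u v] bit_\<mu>[of v] that by auto
  have ex: "\<exists>u. u \<in> V \<and> cl u = i \<and> (bit u \<longleftrightarrow> b)" if i: "i \<in> cl ` V" for i b
  proof -
    from i obtain u where "u \<in> V" "cl u = i" by auto
    then show ?thesis using bit_\<mu>[of u] cl_\<mu>[of u] \<mu>(1)[of u] by (cases "bit u = b") auto
  qed
  \<comment> \<open>The counterpart of \<open>v\<close> on the other side: the vertex with the same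
    bit in the opposing class or, without opponent, the other vertex of the class of
    \<open>v\<close>. The choice is possible by \<open>ex\<close> and unambiguous by
    \<open>uniq\<close>.\<close>
  define \<psi> where "\<psi> v = (SOME u. u \<in> V \<and> cl u = \<pi> (cl v)
      \<and> (bit u \<longleftrightarrow> (if \<pi> (cl v) = cl v then \<not> bit v else bit v)))" for v
  have \<psi>: "\<psi> v \<in> V" "cl (\<psi> v) = \<pi> (cl v)"
      "bit (\<psi> v) \<longleftrightarrow> (if \<pi> (cl v) = cl v then \<not> bit v else bit v)" if "v \<in> V" for v
  proof -
    have "\<pi> (cl v) \<in> cl ` V" using \<pi>(1) that by auto
    from someI_ex[OF ex[OF this]]
    have "\<psi> v \<in> V \<and> cl (\<psi> v) = \<pi> (cl v)
        \<and> (bit (\<psi> v) \<longleftrightarrow> (if \<pi> (cl v) = cl v then \<not> bit v else bit v))"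
      unfolding \<psi>_def .
    then show "\<psi> v \<in> V" "cl (\<psi> v) = \<pi> (cl v)"
      "bit (\<psi> v) \<longleftrightarrow> (if \<pi> (cl v) = cl v then \<not> bit v else bit v)" by blast+
  qed
  define f where "f v = {cl v, \<pi> (cl v)}" for v
  \<comment> \<open>In a match, whole classes are opposed and the order of labels picks the side; a
    class without opponent is split by \<open>bit\<close>.\<close>
  define s where "s v \<longleftrightarrow> (if \<pi> (cl v) = cl v then bit v else cl v < \<pi> (cl v))" for v
  have \<pi>\<pi>: "\<pi> (\<pi> (cl v)) = cl v" if "v \<in> V" for v using \<pi>(2) that by auto
  have EV: "u \<in> V" "v \<in> V" if "{u, v} \<in> E" for u v
    using that E by (auto simp: nsets_def)
  obtain X Y where XY: "X \<union> Y = V" "X \<inter> Y = {}" "card X = card Y"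
    "total_weight E w + total_weight {e \<in> E. \<exists>u v. e = {u, v} \<and> f u = f v} w
      \<le> 2 * cut_weight E w X Y"
  proof (rule exists_orientation_cut[OF fin E, of \<psi> f s w])
    show "\<psi> v \<in> V" if "v \<in> V" for v using \<psi> that by blast
    show "\<psi> (\<psi> v) = v" if "v \<in> V" for v
      by (rule uniq) (use \<psi>[OF that] \<psi>[of "\<psi> v"] \<pi>\<pi>[OF that] that in auto)
    show "f (\<psi> v) = f v" if "v \<in> V" for v
      using \<psi>[OF that] \<pi>\<pi>[OF that] by (auto simp: f_def)
    show "s (\<psi> v) \<longleftrightarrow> \<not> s v" if "v \<in> V" for v
      using \<psi>[OF that] \<pi>\<pi>[OF that] by (auto simp: s_def)
    show "s u \<longleftrightarrow> \<not> s v" if e: "{u, v} \<in> E" and fe: "f u = f v" for u v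
    proof -
      note V = EV[OF e]
      have "u \<noteq> v" using e E by (auto simp: nsets_def)
      moreover have "u \<noteq> \<mu> v" using e \<mu>E[OF V(2)] by (auto simp: insert_commute)
      ultimately have ne: "cl u \<noteq> cl v" using cl[OF V] by simp
      then have "cl v = \<pi> (cl u)" "cl u = \<pi> (cl v)"
        using fe by (auto simp: f_def doubleton_eq_iff)
      then show ?thesis using ne by (auto simp: s_def)
    qed
  qed blast
  have "finite E" using finite_subset[OF E] fin by (simp add: finite_imp_finite_nsets)
  moreover have "f u = f v" if "{u, v} \<in> E" "\<pi> (cl u) = cl v" for u v
    using that(2) \<pi>\<pi>[OF EV(1)[OF that(1)]] by (auto simp: f_def)
  ultimately have "total_weight {e \<in> E. \<exists>u v. e = {u, v} \<and> \<pi> (cl u) = cl v} w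
      \<le> total_weight {e \<in> E. \<exists>u v. e = {u, v} \<and> f u = f v} w"
    using w by (intro total_weight_mono) (auto simp: weight_function_def, blast)
  then show thesis using that XY by fastforce
qed

section \<open>Round-robin schedules and the heaviest round\<close>

lemma round_robin:
  fixes c d :: nat
  assumes "0 < c" "d = (if even c then c - 1 else c)"
  obtains \<pi> :: "nat \<Rightarrow> nat \<Rightarrow> nat"
  where "\<And>r i. r < d \<Longrightarrow> i < c \<Longrightarrow> \<pi> r i < c" "\<And>r i. r < d \<Longrightarrow> i < c \<Longrightarrow> \<pi> r (\<pi> r i) = i"
    "\<And>i j. i < c \<Longrightarrow> j < c \<Longrightarrow> i \<noteq> j \<Longrightarrow> \<exists>r<d. \<pi> r i = j"
proof -
  \<comment> \<open>\<open>\<rho> r i\<close> is \<open>r - i\<close> modulo \<open>d\<close>. As \<open>d\<close> is odd, it has a unique fixed point \<open>z r\<close>, which sits out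
    round \<open>r\<close> if \<open>c = d\<close> and plays against the extra player \<open>d\<close> if \<open>c = d + 1\<close>.\<close>
  define \<rho> where "\<rho> r i = (if i \<le> r then r - i else r + d - i)" for r i :: nat
  have \<rho>: "\<rho> r i < d" "\<rho> r (\<rho> r i) = i" if "r < d" "i < d" for r i
    using that by (auto simp: \<rho>_def)
  have \<rho>_ex: "\<exists>r<d. \<rho> r i = j" if "i < d" "j < d" for i j
  proof (cases "i + j < d")
    case True
    then show ?thesis by (intro exI[of _ "i + j"]) (simp add: \<rho>_def)
  next
    case False
    then show ?thesis using that by (intro exI[of _ "i + j - d"]) (auto simp: \<rho>_def)
  qed
  show thesis
  proof (cases "even c")
    case False
    then show thesis using that[of \<rho>] \<rho> \<rho>_ex assms by simp
  next
    case True
    then have d: "odd d" "c = Suc d" using assms by auto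
    \<comment> \<open>As \<open>d\<close> is odd, exactly one of \<open>r\<close> and
      \<open>r + d\<close> is even; its half solves \<open>2 * i = r\<close> modulo
      \<open>d\<close>.\<close>
    define z where "z r = (if even r then r div 2 else (r + d) div 2)" for r
    have zz: "2 * z r = (if even r then r else r + d)" for r
      using d(1) by (simp add: z_def)
    have z: "z r < d" "\<rho> r i = i \<longleftrightarrow> i = z r" if "r < d" "i < d" for r i
    proof -
      show "z r < d" using zz[of r] that by (auto split: if_splits)
      have "\<rho> r i = i \<longleftrightarrow> 2 * i = r \<or> 2 * i = r + d"
        using that unfolding \<rho>_def by (cases "i \<le> r") auto
      also have "\<dots> \<longleftrightarrow> 2 * i = (if even r then r else r + d)"
        using d(1) by (metis dvd_triv_left even_add)
      also have "\<dots> \<longleftrightarrow> i = z r" using zz[of r] by linarith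
      finally show "\<rho> r i = i \<longleftrightarrow> i = z r" .
    qed
    \<comment> \<open>Under \<open>\<rho>\<close> player \<open>i\<close> meets itself in some
      round; in that round it plays against the extra player \<open>d\<close>.\<close>
    have z_ex: "\<exists>r<d. z r = i" if "i < d" for i
      using \<rho>_ex[OF that that] z(2)[OF _ that] by metis
    define \<pi> where "\<pi> r i = (if i = d then z r else if i = z r then d else \<rho> r i)" for r i
    show thesis
    proof (rule that[of \<pi>])
      fix r i assume r: "r < d" and i: "i < c"
      show "\<pi> r i < c"
        using z(1)[OF r r] \<rho>(1)[OF r] i d(2) by (auto simp: \<pi>_def less_Suc_eq)
      show "\<pi> r (\<pi> r i) = i"
      proof (cases "i = d \<or> i = z r")
        case True
        then show ?thesis using z(1)[OF r r] by (auto simp: \<pi>_def)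
      next
        case False
        then have "i < d" using i d(2) by simp
        then have "\<rho> r i < d" "\<rho> r (\<rho> r i) = i" "\<rho> r i \<noteq> z r"
          using \<rho>[OF r] z(2)[OF r] False by metis+
        then show ?thesis using False by (simp add: \<pi>_def)
      qed
    next
      fix i j assume ij: "i < c" "j < c" "i \<noteq> j"
      show "\<exists>r<d. \<pi> r i = j"
      proof (cases "i = d \<or> j = d")
        case True
        then show ?thesis using z_ex[of i] z_ex[of j] ij d(2) by (auto simp: \<pi>_def less_Suc_eq)
      next
        case False
        then have "i < d" "j < d" using ij d(2) by auto
        then obtain r where "r < d" "\<rho> r i = j" using \<rho>_ex by blast
        moreover have "i \<noteq> z r" using \<open>i < d\<close> calculation z(2) ij(3) by metis
        ultimately show ?thesis using False by (auto simp: \<pi>_def)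
      qed
    qed
  qed
qed

lemma exists_cut_complement_matching:
  fixes \<mu> :: "'a::linorder \<Rightarrow> 'a"
  assumes fin: "finite V" and c: "card V = 2 * c" "0 < c"
    and d: "d = (if even c then c - 1 else c)"
    and E: "E \<subseteq> nsets V 2" and w: "weight_function E w"
    and \<mu>: "\<And>v. v \<in> V \<Longrightarrow> \<mu> v \<in> V" "\<And>v. v \<in> V \<Longrightarrow> \<mu> (\<mu> v) = v" "\<And>v. v \<in> V \<Longrightarrow> \<mu> v \<noteq> v"
    and \<mu>E: "\<And>v. v \<in> V \<Longrightarrow> {v, \<mu> v} \<notin> E"
  obtains X Y where "X \<union> Y = V" "X \<inter> Y = {}" "card X = card Y"
    "(1 + 1 / real d) * total_weight E w \<le> 2 * cut_weight E w X Y"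
proof -
  define C where "C = (\<lambda>v. {v, \<mu> v}) ` V"
  have cC: "card C = c" "finite C"
    using card_fixpoint_free_involution[OF fin \<mu>] c fin by (auto simp: C_def)
  then obtain h where h: "bij_betw h C {..<c}"
    using ex_bij_betw_finite_nat lessThan_atLeast0 by metis
  define cl where "cl v = h {v, \<mu> v}" for v
  have clV: "cl ` V = {..<c}"
    using bij_betw_imp_surj_on[OF h] by (simp add: cl_def C_def image_image)
  have cl: "cl u = cl v \<longleftrightarrow> u = v \<or> u = \<mu> v" if "u \<in> V" "v \<in> V" for u v
  proof -
    have "cl u = cl v \<longleftrightarrow> {u, \<mu> u} = {v, \<mu> v}"
      using inj_on_eq_iff[OF bij_betw_imp_inj_on[OF h]] that by (simp add: cl_def C_def)
    then show ?thesis using \<mu>[OF that(1)] \<mu>[OF that(2)] by (auto simp: doubleton_eq_iff)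
  qed
  obtain \<pi> where \<pi>: "\<And>r i. r < d \<Longrightarrow> i < c \<Longrightarrow> \<pi> r i < c"
      "\<And>r i. r < d \<Longrightarrow> i < c \<Longrightarrow> \<pi> r (\<pi> r i) = i"
      "\<And>i j. i < c \<Longrightarrow> j < c \<Longrightarrow> i \<noteq> j \<Longrightarrow> \<exists>r<d. \<pi> r i = j"
    using round_robin[OF c(2) d] by blast
  define F where "F r = {e \<in> E. \<exists>u v. e = {u, v} \<and> \<pi> r (cl u) = cl v}" for r
  have finE: "finite E" using finite_subset[OF E] fin by (simp add: finite_imp_finite_nsets)
  have d0: "0 < d" using c d by (auto elim: evenE)
  have cover: "E \<subseteq> (\<Union>r<d. F r)"
  proof
    fix e assume e: "e \<in> E"
    obtain u v where uv: "e = {u, v}" "u \<in> V" "v \<in> V" "u \<noteq> v" using edge_cases[OF E e] .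
    have "u \<noteq> \<mu> v" using e \<mu>E[OF uv(3)] uv(1) by (auto simp: insert_commute)
    then have "cl u \<noteq> cl v" using cl uv by simp
    moreover have "cl u < c" "cl v < c" using clV uv by auto
    ultimately show "e \<in> (\<Union>r<d. F r)" using \<pi>(3)[of "cl u" "cl v"] e uv(1) by (auto simp: F_def)
  qed
  \<comment> \<open>Pigeonhole: the \<open>d\<close> rounds cover \<open>E\<close>. Coverage alone
    is used, so the double count below yields an inequality.\<close>
  have "\<exists>r<d. total_weight E w / d \<le> total_weight (F r) w"
  proof (rule ccontr)
    assume "\<not> ?thesis"
    then have "(\<Sum>r<d. total_weight (F r) w) < (\<Sum>r<d. total_weight E w / d)"
      using d0 by (intro sum_strict_mono) (auto simp: not_le)
    also have "\<dots> = total_weight E w" using d0 by simp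
    also have "\<dots> \<le> (\<Sum>e\<in>E. \<Sum>r<d. if e \<in> F r then w e else 0)"
      unfolding total_weight_def
    proof (rule sum_mono)
      fix e assume e: "e \<in> E"
      then obtain r where r: "r < d" "e \<in> F r" using cover by auto
      have "(if e \<in> F r then w e else 0) \<le> (\<Sum>r<d. if e \<in> F r then w e else 0)"
        by (rule member_le_sum) (use r(1) e w in \<open>auto simp: weight_function_def\<close>)
      then show "w e \<le> (\<Sum>r<d. if e \<in> F r then w e else 0)" using r(2) by simp
    qed
    also have "\<dots> = (\<Sum>r<d. \<Sum>e\<in>E. if e \<in> F r then w e else 0)"
      by (rule sum.swap)
    also have "\<dots> = (\<Sum>r<d. total_weight (F r) w)"
      using finE by (simp add: total_weight_def sum.If_cases F_def Int_def)
    finally show False by simp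
  qed
  then obtain r where r: "r < d" "total_weight E w / d \<le> total_weight (F r) w" by blast
  obtain X Y where XY: "X \<union> Y = V" "X \<inter> Y = {}" "card X = card Y"
    "total_weight E w + total_weight (F r) w \<le> 2 * cut_weight E w X Y"
  proof (rule exists_cut_class_involution[OF fin E w \<mu> \<mu>E cl, of "\<pi> r"])
    show "\<pi> r i \<in> cl ` V" "\<pi> r (\<pi> r i) = i" if "i \<in> cl ` V" for i
      using \<pi>(1,2)[OF r(1)] that unfolding clV by auto
  qed (auto simp: F_def)
  then have "(1 + 1 / real d) * total_weight E w \<le> 2 * cut_weight E w X Y"
    using r by (simp add: distrib_right)
  then show thesis using that XY by blast
qed

section \<open>Perfect matchings in the complement of a graph without large bicliques\<close>

definition has_biclique :: "'a set \<Rightarrow> 'a set set \<Rightarrow> nat \<Rightarrow> nat \<Rightarrow> bool" where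
  "has_biclique V E a b \<longleftrightarrow> (\<exists>A B. A \<subseteq> V \<and> B \<subseteq> V \<and> A \<inter> B = {} \<and> card A = a \<and> card B = b
     \<and> (\<forall>x\<in>A. \<forall>y\<in>B. {x, y} \<in> E))"

text \<open>If both sides are nonempty, every vertex of the biclique is an endpoint of an edge.
  Hence the isolated dummy vertex added in \<open>bisection_bound\<close> creates no new
  biclique.\<close>

lemma has_biclique_restrict:
  assumes "has_biclique V' E a b" "E \<subseteq> nsets V 2" "0 < a" "0 < b"
  shows "has_biclique V E a b"
proof -
  obtain A B where AB: "A \<inter> B = {}" "card A = a" "card B = b" "\<forall>x\<in>A. \<forall>y\<in>B. {x, y} \<in> E"
    using assms(1) unfolding has_biclique_def by blast
  have "A \<noteq> {}" "B \<noteq> {}" using AB assms(3,4) by auto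
  moreover have "x \<in> V \<and> y \<in> V" if "x \<in> A" "y \<in> B" for x y
    using AB(4) that assms(2) by (auto simp: nsets_def)
  ultimately have "A \<subseteq> V" "B \<subseteq> V" by blast+
  then show ?thesis using AB unfolding has_biclique_def by blast
qed

lemma complement_perfect_matching:
  assumes fin: "finite V" and ev: "even (card V)" and qb: "2 * q + b \<le> card V"
    and no1: "\<not> has_biclique V E 1 b" and noq: "\<not> has_biclique V E q q"
  obtains \<mu> where "\<And>v. v \<in> V \<Longrightarrow> \<mu> v \<in> V" "\<And>v. v \<in> V \<Longrightarrow> \<mu> (\<mu> v) = v"
    "\<And>v. v \<in> V \<Longrightarrow> \<mu> v \<noteq> v" "\<And>v. v \<in> V \<Longrightarrow> {v, \<mu> v} \<notin> E"
proof -
  \<comment> \<open>Matchings of the complement are encoded as involutions whose fixed points are the unmatched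
    vertices; a matching without augmenting paths of length at most 5 is perfect.\<close>
  define P where "P \<mu> \<longleftrightarrow> (\<forall>v\<in>V. \<mu> v \<in> V \<and> \<mu> (\<mu> v) = v \<and> (\<mu> v \<noteq> v \<longrightarrow> {v, \<mu> v} \<notin> E))" for \<mu>
  define fix_set where "fix_set \<mu> = {v \<in> V. \<mu> v = v}" for \<mu>
  have "P id" by (simp add: P_def)
  then obtain \<mu> where P: "P \<mu>" and min: "\<And>\<nu>. P \<nu> \<Longrightarrow> card (fix_set \<mu>) \<le> card (fix_set \<nu>)"
    using ex_has_least_nat[of P id "\<lambda>\<mu>. card (fix_set \<mu>)"] by blast
  have \<mu>: "\<mu> v \<in> V" "\<mu> (\<mu> v) = v" "\<mu> v \<noteq> v \<Longrightarrow> {v, \<mu> v} \<notin> E" if "v \<in> V" for v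
    using P that by (auto simp: P_def)
  have min': "\<not> fix_set \<nu> \<subset> fix_set \<mu>" if "P \<nu>" for \<nu>
    using min[OF that] psubset_card_mono[of "fix_set \<mu>" "fix_set \<nu>"] fin
    by (auto simp: fix_set_def)
  have "fix_set \<mu> = {}"
  proof (rule ccontr)
    assume "fix_set \<mu> \<noteq> {}"
    then obtain u where u: "u \<in> fix_set \<mu>" by blast
    \<comment> \<open>Matched vertices come in pairs, so the number of unmatched ones is even and a
      second one \<open>v\<close> exists besides \<open>u\<close>.\<close>
    have "card (V - fix_set \<mu>) = 2 * card ((\<lambda>v. {v, \<mu> v}) ` (V - fix_set \<mu>))"
      by (rule card_fixpoint_free_involution) (use fin \<mu> in \<open>auto simp: fix_set_def\<close>)
    then have "even (card (V - fix_set \<mu>))" by simp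
    moreover have "card V = card (fix_set \<mu>) + card (V - fix_set \<mu>)"
      using fin card_Un_disjoint[of "fix_set \<mu>" "V - fix_set \<mu>"]
      by (auto simp: fix_set_def Un_absorb1)
    ultimately have "even (card (fix_set \<mu>))" using ev by simp
    then have "fix_set \<mu> \<noteq> {u}" by auto
    then obtain v where v: "v \<in> fix_set \<mu>" "u \<noteq> v" using u by blast
    have uV: "u \<in> V" "\<mu> u = u" and vV: "v \<in> V" "\<mu> v = v" using u v by (auto simp: fix_set_def)
    \<comment> \<open>No augmenting path of length 1. Consequently all complement neighbours of
      \<open>u\<close> and \<open>v\<close> are matched (\<open>N_moved\<close>).\<close>
    have fix_adj: "{x, y} \<in> E" if xy: "x \<in> fix_set \<mu>" "y \<in> fix_set \<mu>" "x \<noteq> y" for x y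
    proof (rule ccontr)
      assume ne: "{x, y} \<notin> E"
      have xy': "x \<in> V" "y \<in> V" "\<mu> x = x" "\<mu> y = y" using xy by (auto simp: fix_set_def)
      have img: "\<mu> a \<noteq> x" "\<mu> a \<noteq> y" if "a \<in> V" "a \<noteq> x" "a \<noteq> y" for a
        using \<mu>(2)[OF that(1)] that xy' by auto
      have "P (\<mu>(x := y, y := x))"
        unfolding P_def using \<mu> img ne xy(3) xy' by (auto simp: insert_commute)
      moreover have "fix_set (\<mu>(x := y, y := x)) \<subset> fix_set \<mu>"
        using xy xy' by (auto simp: fix_set_def)
      ultimately show False using min' by blast
    qed
    define N where "N x = {y \<in> V. y \<noteq> x \<and> {x, y} \<notin> E}" for x
    \<comment> \<open>Fewer than \<open>2 * q\<close> complement neighbours would leave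
      \<open>x\<close> at least \<open>b\<close> neighbours in \<open>E\<close>, which form a star
      of type \<open>(1, b)\<close>; the strict inequality makes up for \<open>x\<close>
      itself.\<close>
    have cardN: "2 * q \<le> card (N x)" if x: "x \<in> V" for x
    proof (rule ccontr)
      assume small: "\<not> 2 * q \<le> card (N x)"
      define D where "D = V - {x} - N x"
      have "card D = card V - 1 - card (N x)"
        unfolding D_def using x fin by (subst card_Diff_subset) (auto simp: N_def)
      then have "b \<le> card D" using small qb by simp
      then obtain B where "B \<subseteq> D" "card B = b" by (meson obtain_subset_with_card_n)
      then have "has_biclique V E 1 b" unfolding has_biclique_def
        using x by (intro exI[of _ "{x}"] exI[of _ B]) (auto simp: D_def N_def)
      then show False using no1 by simp
    qed
    have N_moved: "x \<in> V" "\<mu> x \<noteq> x" "\<mu> x \<noteq> u" "\<mu> x \<noteq> v" "x \<noteq> u" "x \<noteq> v"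
      if "x \<in> N u \<or> x \<in> N v" for x
    proof -
      show x: "x \<in> V" using that by (auto simp: N_def)
      show mv: "\<mu> x \<noteq> x"
        using that fix_adj[OF u, of x] fix_adj[OF v(1), of x] x by (auto simp: N_def fix_set_def)
      show "\<mu> x \<noteq> u" "\<mu> x \<noteq> v" "x \<noteq> u" "x \<noteq> v" using \<mu>(2)[OF x] uV vV mv by auto
    qed
    \<comment> \<open>Otherwise \<open>u\<close>, \<open>x\<close>, \<open>\<mu> x\<close>,
      \<open>v\<close> is an augmenting path of length 3.\<close>
    have aug3: "\<mu> x \<notin> N v" if x: "x \<in> N u" for x
    proof
      assume mx: "\<mu> x \<in> N v"
      note xm = N_moved[of x] N_moved[of "\<mu> x"]
      define \<nu> where "\<nu> = \<mu>(u := x, x := u, v := \<mu> x, \<mu> x := v)"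
      have img: "\<mu> a \<noteq> x" "\<mu> a \<noteq> u" "\<mu> a \<noteq> v" "\<mu> a \<noteq> \<mu> x"
        if "a \<in> V" "a \<noteq> x" "a \<noteq> u" "a \<noteq> v" "a \<noteq> \<mu> x" for a
        using \<mu>(2)[OF that(1)] \<mu>(2)[of x] that uV vV xm x by auto
      have "P \<nu>"
        unfolding P_def
      proof
        fix a assume a: "a \<in> V"
        have E': "{u, x} \<notin> E" "{x, u} \<notin> E" "{v, \<mu> x} \<notin> E" "{\<mu> x, v} \<notin> E"
          using x mx by (auto simp: N_def insert_commute)
        consider "a = u" | "a = x" | "a = v" | "a = \<mu> x"
          | "a \<noteq> u" "a \<noteq> x" "a \<noteq> v" "a \<noteq> \<mu> x" by blast
        then show "\<nu> a \<in> V \<and> \<nu> (\<nu> a) = a \<and> (\<nu> a \<noteq> a \<longrightarrow> {a, \<nu> a} \<notin> E)"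
        proof cases
          case 5
          then show ?thesis using img[OF a] \<mu>[OF a] by (simp add: \<nu>_def)
        qed (use E' xm x mx v(2) uV vV in \<open>auto simp: \<nu>_def\<close>)
      qed
      moreover have "fix_set \<nu> \<subset> fix_set \<mu>"
        using uV vV v(2) xm x mx by (auto simp: fix_set_def \<nu>_def)
      ultimately show False using min' by blast
    qed
    \<comment> \<open>Otherwise \<open>u\<close>, \<open>x\<close>, \<open>\<mu> x\<close>,
      \<open>\<mu> z\<close>, \<open>z\<close>, \<open>v\<close> is an augmenting path of length 5;
      \<open>aug3\<close> keeps its vertices distinct.\<close>
    have aug5: "{\<mu> x, \<mu> z} \<in> E" if x: "x \<in> N u" and z: "z \<in> N v" and xz: "x \<noteq> z" for x z
    proof (rule ccontr)
      assume ne: "{\<mu> x, \<mu> z} \<notin> E"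
      note xm = N_moved[of x] N_moved[of z]
      have xV: "x \<in> V" "z \<in> V" using xm x z by auto
      have ne2: "\<mu> x \<noteq> z" "\<mu> z \<noteq> x" "\<mu> x \<noteq> \<mu> z"
        using aug3[OF x] z \<mu>(2) xV xz by metis+
      define \<nu> where "\<nu> = \<mu>(u := x, x := u, v := z, z := v, \<mu> x := \<mu> z, \<mu> z := \<mu> x)"
      have img: "\<mu> a \<noteq> x" "\<mu> a \<noteq> z" "\<mu> a \<noteq> u" "\<mu> a \<noteq> v" "\<mu> a \<noteq> \<mu> x" "\<mu> a \<noteq> \<mu> z"
        if "a \<in> V" "a \<noteq> x" "a \<noteq> u" "a \<noteq> v" "a \<noteq> z" "a \<noteq> \<mu> x" "a \<noteq> \<mu> z" for a
        using \<mu>(2)[OF that(1)] \<mu>(2)[OF xV(1)] \<mu>(2)[OF xV(2)] that uV vV by auto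
      have "P \<nu>"
        unfolding P_def
      proof
        fix a assume a: "a \<in> V"
        have E': "{u, x} \<notin> E" "{x, u} \<notin> E" "{v, z} \<notin> E" "{z, v} \<notin> E" "{\<mu> z, \<mu> x} \<notin> E"
          using x z ne by (auto simp: N_def insert_commute)
        consider "a = u" | "a = x" | "a = v" | "a = z" | "a = \<mu> x" | "a = \<mu> z"
          | "a \<noteq> u" "a \<noteq> x" "a \<noteq> v" "a \<noteq> z" "a \<noteq> \<mu> x" "a \<noteq> \<mu> z" by blast
        then show "\<nu> a \<in> V \<and> \<nu> (\<nu> a) = a \<and> (\<nu> a \<noteq> a \<longrightarrow> {a, \<nu> a} \<notin> E)"
        proof cases
          case 7
          then show ?thesis using img[OF a] \<mu>[OF a] by (simp add: \<nu>_def)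
        qed (use E' ne ne2 xm x z xz v(2) uV vV \<mu>(1)[OF xV(1)] \<mu>(1)[OF xV(2)] in
            \<open>auto simp: \<nu>_def\<close>)
      qed
      moreover have "fix_set \<nu> \<subset> fix_set \<mu>"
        using uV vV v(2) xm x z xz ne2 by (auto simp: fix_set_def \<nu>_def)
      ultimately show False using min' by blast
    qed
    have inj: "inj_on \<mu> V" by (metis \<mu>(2) inj_onI)
    have card_img: "card (\<mu> ` N x) = card (N x)" for x
      by (rule card_image) (auto intro: inj_on_subset[OF inj] simp: N_def)
    \<comment> \<open>By \<open>aug5\<close>, partners of \<open>N u\<close> and of
      \<open>N v\<close> are adjacent whenever they differ. The two sets of partners may overlap;
      having at least \<open>2 * q\<close> elements each, they still contain disjoint subsets of
      size \<open>q\<close>.\<close>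
    obtain A where A: "A \<subseteq> \<mu> ` N u" "card A = q"
      using obtain_subset_with_card_n[of q "\<mu> ` N u"] cardN[OF uV(1)] card_img by auto
    have "finite A" using A(1) fin by (auto simp: N_def intro: finite_subset)
    then have "q \<le> card (\<mu> ` N v - A)"
      using diff_card_le_card_Diff[of A "\<mu> ` N v"] cardN[OF vV(1)] card_img[of v] A(2) by simp
    then obtain B where B: "B \<subseteq> \<mu> ` N v - A" "card B = q" by (meson obtain_subset_with_card_n)
    have "{a, b} \<in> E" if "a \<in> A" "b \<in> B" for a b
      using that A(1) B(1) aug5 by blast
    moreover have "A \<subseteq> V" "B \<subseteq> V" using A(1) B(1) \<mu>(1) by (auto simp: N_def)
    ultimately have "has_biclique V E q q"
      unfolding has_biclique_def using A(2) B
      by (intro exI[of _ A] exI[of _ B]) auto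
    then show False using noq by simp
  qed
  then have "\<mu> v \<noteq> v" if "v \<in> V" for v using that by (auto simp: fix_set_def)
  then show thesis using that \<mu> by blast
qed

text \<open>There are \<open>c = (n + 1) div 2\<close> pairs, so
  \<open>d \<le> c \<le> n div 2 + 1 \<le> k + 1\<close>. As \<open>d\<close> is odd, even
  \<open>d \<le> k\<close> holds for odd \<open>k\<close>. The factor \<open>(1 + 1 / d) / 2\<close>
  decreases in \<open>d\<close>, and its values at \<open>k\<close> and \<open>k + 1\<close> are the
  two claimed fractions.\<close>

lemma bisection_bound:
  fixes w :: "nat set \<Rightarrow> real"
  assumes E: "E \<subseteq> nsets {1..n} 2" and w: "weight_function E w"
    and q: "0 < q" "2 * q < n"
    and no1: "\<not> has_biclique {1..n} E 1 (n - 2 * q)" and noq: "\<not> has_biclique {1..n} E q q"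
    and k: "n div 2 \<le> k"
  obtains X Y where "bisection {1..n} X Y"
    "odd k \<Longrightarrow> (real k + 1) / (2 * real k) * total_weight E w \<le> cut_weight E w X Y"
    "even k \<Longrightarrow> (real k + 2) / (2 * (real k + 1)) * total_weight E w \<le> cut_weight E w X Y"
proof -
  \<comment> \<open>The vertex 0 is the dummy for odd \<open>n\<close>; no edge of \<open>E\<close>
    contains it.\<close>
  define V where "V = (if even n then {1..n} else {0..n})"
  define c where "c = (n + 1) div 2"
  define d where "d = (if even c then c - 1 else c)"
  have V: "finite V" "card V = 2 * c" "{1..n} \<subseteq> V" "V \<subseteq> insert 0 {1..n}" "n \<le> card V"
    by (auto simp: V_def c_def elim!: evenE oddE)
  have c0: "0 < c" using q by (simp add: c_def)
  have EV: "E \<subseteq> nsets V 2" using E nsets_mono[OF V(3)] by blast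
  obtain \<mu> where \<mu>: "\<And>v. v \<in> V \<Longrightarrow> \<mu> v \<in> V" "\<And>v. v \<in> V \<Longrightarrow> \<mu> (\<mu> v) = v"
    "\<And>v. v \<in> V \<Longrightarrow> \<mu> v \<noteq> v" "\<And>v. v \<in> V \<Longrightarrow> {v, \<mu> v} \<notin> E"
  proof (rule complement_perfect_matching[of V q "n - 2 * q" E])
    show "\<not> has_biclique V E 1 (n - 2 * q)" "\<not> has_biclique V E q q"
      using has_biclique_restrict[OF _ E] no1 noq q by fastforce+
  qed (use V q in auto)
  obtain X' Y' where XY: "X' \<union> Y' = V" "X' \<inter> Y' = {}" "card X' = card Y'"
    "(1 + 1 / real d) * total_weight E w \<le> 2 * cut_weight E w X' Y'"
    using exists_cut_complement_matching[OF V(1,2) c0 d_def EV w \<mu>] by blast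
  define X where "X = X' \<inter> {1..n}"
  define Y where "Y = Y' \<inter> {1..n}"
  have fXY: "finite X'" "finite Y'" using V(1) XY(1) by (auto intro: finite_subset)
  \<comment> \<open>Deleting the dummy shrinks a side by at most one, so equal sides become a
    bisection.\<close>
  have near: "card Z' \<le> card (Z' \<inter> {1..n}) + 1" "card (Z' \<inter> {1..n}) \<le> card Z'"
    if "finite Z'" "Z' \<subseteq> V" for Z'
  proof -
    have "card Z' \<le> card (insert 0 (Z' \<inter> {1..n}))"
      by (rule card_mono) (use that V(4) in auto)
    also have "\<dots> \<le> card (Z' \<inter> {1..n}) + 1" using card_insert_le_m1 by (simp add: card_insert_if)
    finally show "card Z' \<le> card (Z' \<inter> {1..n}) + 1" .
    show "card (Z' \<inter> {1..n}) \<le> card Z'" using that by (intro card_mono) auto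
  qed
  have "bisection {1..n} X Y"
    unfolding bisection_def X_def Y_def
    using XY(1-3) V(3) near[OF fXY(1)] near[OF fXY(2)] by auto
  moreover have "cut_edges E X Y = cut_edges E X' Y'"
    using E by (auto simp: cut_edges_def X_def Y_def nsets_def)
  then have cut: "(1 + 1 / real d) / 2 * total_weight E w \<le> cut_weight E w X Y"
    using XY(4) by (simp add: cut_weight_def)
  have W: "0 \<le> total_weight E w"
    using w by (auto simp: total_weight_def weight_function_def intro: sum_nonneg)
  have d: "odd d" "d \<le> k + 1" using c0 k by (auto simp: d_def c_def)
  have mono: "(1 + 1 / real m) / 2 * total_weight E w \<le> cut_weight E w X Y" if "d \<le> m" for m
  proof -
    have "(1 + 1 / real m) / 2 \<le> (1 + 1 / real d) / 2"
      using that odd_pos[OF d(1)] by (simp add: frac_le)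
    from mult_right_mono[OF this W] show ?thesis using cut by linarith
  qed
  have "(real k + 1) / (2 * real k) * total_weight E w \<le> cut_weight E w X Y" if "odd k"
  proof -
    have "d \<noteq> k + 1" using d(1) that by auto
    then have "d \<le> k" using d(2) by simp
    moreover have "(1 + 1 / real k) / 2 = (real k + 1) / (2 * real k)"
      using odd_pos[OF that] by (simp add: field_simps)
    ultimately show ?thesis using mono by metis
  qed
  moreover have "(real k + 2) / (2 * (real k + 1)) * total_weight E w \<le> cut_weight E w X Y"
  proof -
    have "(1 + 1 / real (k + 1)) / 2 = (real k + 2) / (2 * (real k + 1))"
      by (simp add: field_simps)
    then show ?thesis using mono[OF d(2)] by metis
  qed
  ultimately show thesis using that by blast
qed

section \<open>Random graphs\<close>

text \<open>The probability of \<open>Q\<close> in the uniform random graph, expressed by counting;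
  the denominator is justified by \<open>card_simple_graphs\<close>.\<close>

definition graph_fraction :: "(nat set set \<Rightarrow> bool) \<Rightarrow> nat \<Rightarrow> real" where
  "graph_fraction Q n = real (card {E. E \<subseteq> nsets {1..n} 2 \<and> Q E}) / 2 ^ (n choose 2)"

lemma finite_graphs: "finite {E. E \<subseteq> nsets {1..n::nat} 2 \<and> Q E}"
proof -
  have "finite (Pow (nsets {1..n} 2))" by (simp add: finite_imp_finite_nsets)
  then show ?thesis by (rule rev_finite_subset) auto
qed

lemma graph_fraction_nonneg: "0 \<le> graph_fraction Q n"
  by (simp add: graph_fraction_def)

lemma graph_fraction_subadd:
  assumes "\<And>E. E \<subseteq> nsets {1..n} 2 \<Longrightarrow> Q E \<Longrightarrow> Q1 E \<or> Q2 E"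
  shows "graph_fraction Q n \<le> graph_fraction Q1 n + graph_fraction Q2 n"
proof -
  let ?S = "\<lambda>Q. {E. E \<subseteq> nsets {1..n} 2 \<and> Q E}"
  have "card (?S Q) \<le> card (?S Q1 \<union> ?S Q2)"
    by (rule card_mono) (use finite_graphs assms in auto)
  also have "\<dots> \<le> card (?S Q1) + card (?S Q2)" by (rule card_Un_le)
  finally have "real (card (?S Q)) \<le> real (card (?S Q1)) + real (card (?S Q2))" by linarith
  then show ?thesis
    unfolding graph_fraction_def add_divide_distrib[symmetric] by (rule divide_right_mono) simp
qed

lemma almost_all_graphsI:
  assumes "(\<lambda>n. graph_fraction (\<lambda>E. \<not> P {1..n} E) n) \<longlonglongrightarrow> 0"
  shows "almost_all_graphs P"
proof -
  have "real (card {E. simple_graph {1..n} E \<and> P {1..n} E}) / real (card {E. simple_graph {1..n} E})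
      = 1 - graph_fraction (\<lambda>E. \<not> P {1..n} E) n" for n
  proof -
    let ?G = "{E. simple_graph {1..n} E}" and ?A = "{E. simple_graph {1..n} E \<and> P {1..n} E}"
    let ?B = "{E. E \<subseteq> nsets {1..n} 2 \<and> \<not> P {1..n} E}"
    have "?G = ?A \<union> ?B" by (auto simp: simple_graph_def)
    moreover have "card (?A \<union> ?B) = card ?A + card ?B"
    proof (rule card_Un_disjoint)
      show "finite ?A" "finite ?B"
        using finite_graphs[of n "\<lambda>E. P {1..n} E"] finite_graphs[of n "\<lambda>E. \<not> P {1..n} E"]
        by (simp_all add: simple_graph_def)
    qed auto
    ultimately have "card ?A + card ?B = 2 ^ (n choose 2)"
      using card_simple_graphs[of n] by simp
    from arg_cong[OF this, of real]
    have "real (card ?A) = 2 ^ (n choose 2) - real (card ?B)" by simp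
    then show ?thesis
      unfolding card_simple_graphs graph_fraction_def by (simp add: diff_divide_distrib)
  qed
  moreover have "(\<lambda>n. 1 - graph_fraction (\<lambda>E. \<not> P {1..n} E) n) \<longlonglongrightarrow> 1 - 0"
    by (intro tendsto_intros assms)
  ultimately show ?thesis by (simp add: almost_all_graphs_def)
qed

section \<open>Union bound for bicliques\<close>

definition cross_edges :: "'a set \<Rightarrow> 'a set \<Rightarrow> 'a set set" where
  "cross_edges A B = (\<lambda>(x, y). {x, y}) ` (A \<times> B)"

lemma card_cross_edges:
  assumes "A \<inter> B = {}"
  shows "card (cross_edges A B) = card A * card B"
proof -
  have "inj_on (\<lambda>(x, y). {x, y}) (A \<times> B)"
    using assms by (auto simp: inj_on_def doubleton_eq_iff)
  then show ?thesis unfolding cross_edges_def by (simp add: card_image card_cartesian_product)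
qed

lemma cross_edges_subset:
  assumes "A \<subseteq> V" "B \<subseteq> V" "A \<inter> B = {}"
  shows "cross_edges A B \<subseteq> nsets V 2"
  using assms by (auto simp: cross_edges_def nsets_def card_insert_if)

lemma card_supersets_within:
  assumes "finite U" "F \<subseteq> U"
  shows "card {E. F \<subseteq> E \<and> E \<subseteq> U} = 2 ^ (card U - card F)"
proof -
  have "bij_betw (\<lambda>G. G \<union> F) (Pow (U - F)) {E. F \<subseteq> E \<and> E \<subseteq> U}"
    by (rule bij_betw_byWitness[where f' = "\<lambda>E. E - F"]) (use assms in auto)
  then have "card {E. F \<subseteq> E \<and> E \<subseteq> U} = card (Pow (U - F))" by (simp add: bij_betw_same_card)
  also have "\<dots> = 2 ^ (card U - card F)"
    using assms by (simp add: card_Pow card_Diff_subset finite_subset)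
  finally show ?thesis .
qed

text \<open>Union bound over the pairs \<open>(A, B)\<close>: a fixed biclique prescribes
  \<open>a * b\<close> edges and so has probability \<open>1 / 2 ^ (a * b)\<close>.\<close>

lemma graph_fraction_biclique_le:
  "graph_fraction (\<lambda>E. has_biclique {1..n} E a b) n \<le> real (n choose a) * real (n choose b) / 2 ^ (a * b)"
proof -
  define U where "U = nsets {1..n} 2"
  define I where "I = {(A, B). A \<in> nsets {1..n} a \<and> B \<in> nsets {1..n} b \<and> A \<inter> B = {}}"
  define \<F> where "\<F> p = {E. cross_edges (fst p) (snd p) \<subseteq> E \<and> E \<subseteq> U}" for p
  have U: "finite U" "card U = n choose 2"
    by (simp_all add: U_def finite_imp_finite_nsets card_nsets)
  have Isub: "I \<subseteq> nsets {1..n} a \<times> nsets {1..n} b" by (auto simp: I_def)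
  have fin: "finite (nsets {1..n} a \<times> nsets {1..n} b)" by (simp add: finite_imp_finite_nsets)
  then have finI: "finite I" using Isub by (rule rev_finite_subset)
  have "{E. E \<subseteq> nsets {1..n} 2 \<and> has_biclique {1..n} E a b} \<subseteq> (\<Union>p\<in>I. \<F> p)"
  proof safe
    fix E assume E: "E \<subseteq> nsets {1..n} 2" "has_biclique {1..n} E a b"
    then obtain A B where "A \<subseteq> {1..n}" "B \<subseteq> {1..n}" "A \<inter> B = {}" "card A = a" "card B = b"
      "\<forall>x\<in>A. \<forall>y\<in>B. {x, y} \<in> E" unfolding has_biclique_def by blast
    then have "(A, B) \<in> I" "E \<in> \<F> (A, B)"
      using E(1) by (auto simp: I_def \<F>_def U_def nsets_def cross_edges_def intro: finite_subset)
    then show "E \<in> (\<Union>p\<in>I. \<F> p)" by blast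
  qed
  moreover have "finite (\<Union>p\<in>I. \<F> p)"
    using finI U(1) by (auto simp: \<F>_def intro: rev_finite_subset[of "Pow U"])
  ultimately have "card {E. E \<subseteq> nsets {1..n} 2 \<and> has_biclique {1..n} E a b} \<le> card (\<Union>p\<in>I. \<F> p)"
    by (rule card_mono[rotated])
  also have "\<dots> \<le> (\<Sum>p\<in>I. card (\<F> p))" by (rule card_UN_le[OF finI])
  finally have "real (card {E. E \<subseteq> nsets {1..n} 2 \<and> has_biclique {1..n} E a b})
      \<le> real (\<Sum>p\<in>I. card (\<F> p))" by (rule of_nat_mono)
  also have "\<dots> = (\<Sum>p\<in>I. real (card (\<F> p)))" by (rule of_nat_sum)
  also have "\<dots> = (\<Sum>p\<in>I. 2 ^ (n choose 2) / 2 ^ (a * b))"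
  proof (rule sum.cong)
    fix p assume p: "p \<in> I"
    obtain A B where AB: "p = (A, B)" by (cases p)
    have AB': "A \<subseteq> {1..n}" "B \<subseteq> {1..n}" "A \<inter> B = {}" "card A = a" "card B = b"
      using p AB by (auto simp: I_def nsets_def)
    note sub = cross_edges_subset[OF AB'(1-3), folded U_def]
    have c: "card (cross_edges A B) = a * b" using card_cross_edges[OF AB'(3)] AB' by simp
    have "real (card (\<F> p)) = 2 ^ ((n choose 2) - a * b)"
      using card_supersets_within[OF U(1) sub] U(2) c by (simp add: \<F>_def AB)
    \<comment> \<open>Without this the subtraction in the exponent could be truncated and would not
      become a quotient.\<close>
    moreover have "a * b \<le> n choose 2" using card_mono[OF U(1) sub] c U(2) by simp
    ultimately show "real (card (\<F> p)) = 2 ^ (n choose 2) / 2 ^ (a * b)"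
      by (simp add: power_diff)
  qed simp
  also have "\<dots> = real (card I) * (2 ^ (n choose 2) / 2 ^ (a * b))" by simp
  also have "\<dots> \<le> (real (n choose a) * real (n choose b)) * (2 ^ (n choose 2) / 2 ^ (a * b))"
  proof (rule mult_right_mono)
    have "card I \<le> (n choose a) * (n choose b)"
      using card_mono[OF fin Isub] by (simp add: card_cartesian_product card_nsets)
    then show "real (card I) \<le> real (n choose a) * real (n choose b)"
      by (simp flip: of_nat_mult)
  qed simp
  finally show ?thesis by (simp add: graph_fraction_def divide_simps mult_ac)
qed

lemma floor_sqrt_bounds: "real (floor_sqrt n) \<le> sqrt n" "sqrt n - 1 \<le> real (floor_sqrt n)"
proof -
  have "real ((floor_sqrt n)\<^sup>2) \<le> real n"
    by (rule of_nat_mono) (rule floor_sqrt_power2_le)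
  then show "real (floor_sqrt n) \<le> sqrt n" by (intro real_le_rsqrt) simp
  have "real n \<le> real ((Suc (floor_sqrt n))\<^sup>2)"
    by (intro of_nat_mono less_imp_le) (rule Suc_floor_sqrt_power2_gt)
  then have "sqrt n \<le> real (Suc (floor_sqrt n))" by (intro real_le_lsqrt) auto
  then show "sqrt n - 1 \<le> real (floor_sqrt n)" by simp
qed

lemma binomial_le_power: "real (n choose k) \<le> real n ^ k"
proof (cases "k \<le> n")
  case True
  then show ?thesis by (metis binomial_le_pow of_nat_le_iff of_nat_power)
qed (simp add: binomial_eq_0)

text \<open>With \<open>q = floor_sqrt n\<close>, symmetry of the binomial coefficient leaves
  \<open>n powr (2 * sqrt n)\<close>, whose binary logarithm has order \<open>sqrt n * ln n\<close>,
  against an exponent close to \<open>n\<close>. The choice of \<open>q\<close> meets two demands: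
  here \<open>q * ln n\<close> must be small compared with \<open>n\<close>, and in
  \<open>graph_fraction_biclique_tendsto_0\<close> the value \<open>q\<close> must outgrow
  \<open>ln n\<close>.\<close>

lemma graph_fraction_star_tendsto_0:
  "(\<lambda>n. graph_fraction (\<lambda>E. has_biclique {1..n} E 1 (n - 2 * floor_sqrt n)) n) \<longlonglongrightarrow> 0"
proof (rule tendsto_sandwich[where f = "\<lambda>_. 0"])
  show "\<forall>\<^sub>F n in sequentially. graph_fraction (\<lambda>E. has_biclique {1..n} E 1 (n - 2 * floor_sqrt n)) n
      \<le> real n * real n powr (2 * sqrt n) / 2 powr (n - 2 * sqrt n)"
    using eventually_ge_at_top[of 4]
  proof eventually_elim
    case (elim n)
    let ?q = "floor_sqrt n"
    have "2 * sqrt n \<le> sqrt n * sqrt n"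
      using elim by (intro mult_right_mono) (auto intro: real_le_rsqrt)
    then have qn: "2 * ?q \<le> n" using floor_sqrt_bounds(1)[of n] by simp
    have "graph_fraction (\<lambda>E. has_biclique {1..n} E 1 (n - 2 * ?q)) n
        \<le> real (n choose 1) * real (n choose (n - 2 * ?q)) / 2 ^ (1 * (n - 2 * ?q))"
      by (rule graph_fraction_biclique_le)
    also have "\<dots> = real n * real (n choose (2 * ?q)) / 2 ^ (n - 2 * ?q)"
      using qn binomial_symmetric[of "2 * ?q" n] by simp
    also have "\<dots> \<le> real n * real n powr (2 * sqrt n) / 2 powr (n - 2 * sqrt n)"
    proof (intro frac_le mult_left_mono)
      have "real (n choose (2 * ?q)) \<le> real n powr real (2 * ?q)"
        using binomial_le_power[of n "2 * ?q"] elim by (simp only: powr_realpow)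
      also have "\<dots> \<le> real n powr (2 * sqrt n)"
        using elim floor_sqrt_bounds(1)[of n] by (intro powr_mono) auto
      finally show "real (n choose (2 * ?q)) \<le> real n powr (2 * sqrt n)" .
      have "2 powr (n - 2 * sqrt n) \<le> 2 powr real (n - 2 * ?q)"
        using qn floor_sqrt_bounds(1)[of n] by (intro powr_mono) auto
      then show "2 powr (n - 2 * sqrt n) \<le> 2 ^ (n - 2 * ?q)" by (simp add: powr_realpow)
    qed auto
    finally show ?case .
  qed
  show "(\<lambda>n. real n * real n powr (2 * sqrt n) / 2 powr (n - 2 * sqrt n)) \<longlonglongrightarrow> 0"
    by real_asymp
qed (auto simp: graph_fraction_nonneg)

lemma graph_fraction_biclique_tendsto_0:
  "(\<lambda>n. graph_fraction (\<lambda>E. has_biclique {1..n} E (floor_sqrt n) (floor_sqrt n)) n) \<longlonglongrightarrow> 0"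
proof (rule tendsto_sandwich[where f = "\<lambda>_. 0"])
  show "\<forall>\<^sub>F n in sequentially. graph_fraction (\<lambda>E. has_biclique {1..n} E (floor_sqrt n) (floor_sqrt n)) n
      \<le> real n powr (2 * sqrt n) / 2 powr ((sqrt n - 1)\<^sup>2)"
    using eventually_ge_at_top[of 1]
  proof eventually_elim
    case (elim n)
    let ?q = "floor_sqrt n"
    have "graph_fraction (\<lambda>E. has_biclique {1..n} E ?q ?q) n
        \<le> real (n choose ?q) * real (n choose ?q) / 2 ^ (?q * ?q)"
      by (rule graph_fraction_biclique_le)
    also have "\<dots> \<le> real n powr (2 * sqrt n) / 2 powr ((sqrt n - 1)\<^sup>2)"
    proof (intro frac_le)
      have "real (n choose ?q) * real (n choose ?q) \<le> real n ^ ?q * real n ^ ?q"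
        by (intro mult_mono binomial_le_power) auto
      also have "\<dots> = real n powr real (2 * ?q)"
        using elim by (subst powr_realpow) (auto simp: mult_2 power_add)
      also have "\<dots> \<le> real n powr (2 * sqrt n)"
        using elim floor_sqrt_bounds(1)[of n] by (intro powr_mono) auto
      finally show "real (n choose ?q) * real (n choose ?q) \<le> real n powr (2 * sqrt n)" .
      have "(sqrt n - 1)\<^sup>2 \<le> real ?q ^ 2"
        using elim floor_sqrt_bounds(2)[of n] by (intro power_mono) auto
      then have "2 powr ((sqrt n - 1)\<^sup>2) \<le> 2 powr real (?q * ?q)"
        by (intro powr_mono) (auto simp: power2_eq_square)
      then show "2 powr ((sqrt n - 1)\<^sup>2) \<le> 2 ^ (?q * ?q)" by (simp only: powr_realpow)
    qed auto
    finally show ?case .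
  qed
  show "(\<lambda>n. real n powr (2 * sqrt n) / 2 powr ((sqrt n - 1)\<^sup>2)) \<longlonglongrightarrow> 0"
    by real_asymp
qed (auto simp: graph_fraction_nonneg)

section \<open>Binomial estimates and subsets below the middle size\<close>

lemma central_binomial_square_le: "(2 * m + 1) * ((2 * m) choose m)\<^sup>2 \<le> 16 ^ m" for m :: nat
proof (induction m)
  case (Suc m)
  define a where "a = (2 * m) choose m"
  define b where "b = (2 * Suc m) choose Suc m"
  have rec: "(m + 1) * b = 2 * (2 * m + 1) * a"
  proof -
    have "Suc m * b = Suc (Suc (2 * m)) * (Suc (2 * m) choose m)"
      using Suc_times_binomial[of m "Suc (2 * m)"] by (simp add: b_def)
    moreover have "Suc (2 * m) choose m = Suc (2 * m) choose Suc m"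
      using central_binomial_odd[of "Suc (2 * m)"] by simp
    then have "Suc m * (Suc (2 * m) choose m) = Suc (2 * m) * a"
      using Suc_times_binomial[of m "2 * m"] by (simp add: a_def)
    ultimately show ?thesis by (simp add: algebra_simps)
  qed
  \<comment> \<open>The factor \<open>2 * m + 1\<close> in the claim lets the induction close,
    because \<open>(2 * m + 1) * (2 * m + 3) \<le> 4 * (m + 1)\<^sup>2\<close>.\<close>
  have "(m + 1)\<^sup>2 * ((2 * m + 3) * b\<^sup>2) = (2 * m + 3) * ((m + 1) * b)\<^sup>2"
    by (simp add: power2_eq_square algebra_simps)
  also have "\<dots> = 4 * (2 * m + 1) * (2 * m + 3) * ((2 * m + 1) * a\<^sup>2)"
    unfolding rec by (simp add: power2_eq_square algebra_simps)
  also have "\<dots> \<le> 4 * (2 * m + 1) * (2 * m + 3) * 16 ^ m"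
    using Suc.IH by (intro mult_left_mono) (auto simp: a_def)
  also have "\<dots> \<le> (16 * (m + 1)\<^sup>2) * 16 ^ m"
    by (intro mult_right_mono) (auto simp: power2_eq_square algebra_simps)
  finally have "(m + 1)\<^sup>2 * ((2 * m + 3) * b\<^sup>2) \<le> (m + 1)\<^sup>2 * 16 ^ Suc m"
    by (simp add: mult_ac)
  then have "(2 * m + 3) * b\<^sup>2 \<le> 16 ^ Suc m" by simp
  moreover have "2 * Suc m + 1 = 2 * m + 3" by simp
  ultimately show ?case unfolding b_def by (simp only:)
qed simp

text \<open>The middle coefficient is the largest, and for odd \<open>N\<close> it is at most twice
  the central one of \<open>2 * h\<close>. In both parities \<open>N \<le> 2 * h + 1\<close>, so
  \<open>central_binomial_square_le\<close> applies.\<close>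

lemma binomial_le_sqrt: "real (N choose k) * sqrt N \<le> 2 ^ N"
proof -
  define h where "h = N div 2"
  have half: "real (N choose h) * 4 ^ h \<le> 2 ^ N * real ((2 * h) choose h)"
  proof (cases "even N")
    case True
    then have "N = 2 * h" by (simp add: h_def)
    then show ?thesis by (simp add: power_mult)
  next
    case False
    then have N: "N = Suc (2 * h)" by (simp add: h_def)
    have "N choose h \<le> 2 * ((2 * h) choose h)"
    proof (cases h)
      case (Suc j)
      then show ?thesis using binomial_maximum'[of h j] by (simp add: N)
    qed (simp add: N)
    then have "real (N choose h) \<le> 2 * real ((2 * h) choose h)" by linarith
    then show ?thesis by (simp add: N power_mult)
  qed
  have "(real ((2 * h) choose h) * sqrt N)\<^sup>2 = real N * (real ((2 * h) choose h))\<^sup>2"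
    by (simp add: power_mult_distrib)
  also have "\<dots> \<le> real (2 * h + 1) * (real ((2 * h) choose h))\<^sup>2"
  proof (rule mult_right_mono)
    show "real N \<le> real (2 * h + 1)" unfolding h_def by linarith
  qed simp
  also have "\<dots> = real ((2 * h + 1) * ((2 * h) choose h)\<^sup>2)"
    by (simp only: of_nat_mult of_nat_power)
  also have "\<dots> \<le> real (16 ^ h)" by (rule of_nat_mono[OF central_binomial_square_le])
  also have "\<dots> = (4 ^ h)\<^sup>2" by (simp add: power2_eq_square flip: power_mult_distrib)
  finally have central: "real ((2 * h) choose h) * sqrt N \<le> 4 ^ h"
    by (rule power2_le_imp_le) simp
  have "(real (N choose h) * sqrt N) * 4 ^ h = (real (N choose h) * 4 ^ h) * sqrt N"
    by (simp only: mult_ac)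
  also have "\<dots> \<le> (2 ^ N * real ((2 * h) choose h)) * sqrt N"
    by (rule mult_right_mono[OF half]) simp
  also have "\<dots> \<le> 2 ^ N * 4 ^ h"
    unfolding mult.assoc by (rule mult_left_mono[OF central]) simp
  finally have "real (N choose h) * sqrt N \<le> 2 ^ N" by (rule mult_right_le_imp_le) simp
  moreover have "real (N choose k) * sqrt N \<le> real (N choose h) * sqrt N"
    using binomial_maximum[of N k] by (intro mult_right_mono) (auto simp: h_def)
  ultimately show ?thesis by linarith
qed

text \<open>Meant for the neighbourhood of one vertex in \<open>N = n - s\<close> others, with
  \<open>t = n div 2\<close>: leaving out \<open>s\<close> vertices places \<open>t\<close> above
  the middle of \<open>N\<close> by at most \<open>s / 2\<close>, which is within the typical
  deviation of order \<open>sqrt N\<close>.\<close>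

lemma card_small_subsets_le:
  assumes T: "finite T" "card T = N" and t: "2 * t \<le> N + s" "t \<le> N" and N: "4 * s\<^sup>2 \<le> N" "0 < N"
  shows "real (card {R. R \<subseteq> T \<and> card R < t}) \<le> 3 / 4 * 2 ^ N"
proof -
  define L where "L = {R. R \<subseteq> T \<and> card R < t}"
  define H where "H = {R. R \<subseteq> T \<and> N < t + card R}"
  have card_le: "card R \<le> N" if "R \<subseteq> T" for R using that T card_mono by blast
  have fin: "finite L" "finite H" "finite (Pow T)"
    using T(1) by (auto simp: L_def H_def)
  have compl: "card (T - R) = N - card R" if "R \<subseteq> T" for R
    using that T by (simp add: card_Diff_subset finite_subset)
  have "bij_betw (\<lambda>R. T - R) L H"
  proof (rule bij_betw_byWitness[where f' = "\<lambda>R. T - R"])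
    show "(\<lambda>R. T - R) ` L \<subseteq> H" using compl t(2) by (auto simp: L_def H_def)
    show "(\<lambda>R. T - R) ` H \<subseteq> L"
    proof safe
      fix R assume "R \<in> H"
      then show "T - R \<in> L" using compl[of R] card_le[of R] by (auto simp: L_def H_def)
    qed
  qed (auto simp: L_def H_def)
  then have eq: "card L = card H" by (rule bij_betw_same_card)
  \<comment> \<open>Complementation gives \<open>card L = card H\<close>, and only few sets, of size close to \<open>N / 2\<close>, lie in both.\<close>
  have "card L + card H = card (L \<union> H) + card (L \<inter> H)"
    using fin by (intro card_Un_Int) auto
  also have "card (L \<union> H) \<le> card (Pow T)"
    by (rule card_mono) (use fin in \<open>auto simp: L_def H_def\<close>)
  finally have "2 * card L \<le> 2 ^ N + card (L \<inter> H)" using eq T by (simp add: card_Pow)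
  from of_nat_mono[OF this, where 'a = real]
  have "2 * real (card L) \<le> 2 ^ N + real (card (L \<inter> H))" by simp
  moreover have "real (card (L \<inter> H)) \<le> real s * (2 ^ N / sqrt N)"
  proof -
    \<comment> \<open>At most \<open>s\<close> sizes occur, as \<open>2 * t \<le> N + s\<close>, and
      each contributes at most \<open>2 ^ N / sqrt N\<close>. With \<open>2 * s \<le> sqrt N\<close>
      this totals at most half of all subsets, whence the constant
      \<open>3 / 4 = (1 + 1 / 2) / 2\<close>.\<close>
    have "L \<inter> H \<subseteq> (\<Union>i\<in>{N + 1 - t..<t}. nsets T i)"
    proof
      fix R assume "R \<in> L \<inter> H"
      then have "R \<subseteq> T" "card R \<in> {N + 1 - t..<t}" by (auto simp: L_def H_def)
      then show "R \<in> (\<Union>i\<in>{N + 1 - t..<t}. nsets T i)"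
        using T(1) by (auto simp: nsets_def intro: finite_subset)
    qed
    then have "card (L \<inter> H) \<le> card (\<Union>i\<in>{N + 1 - t..<t}. nsets T i)"
      using T(1) by (intro card_mono) (auto simp: finite_imp_finite_nsets)
    also have "\<dots> \<le> (\<Sum>i\<in>{N + 1 - t..<t}. card (nsets T i))" by (rule card_UN_le) simp
    also have "\<dots> = (\<Sum>i\<in>{N + 1 - t..<t}. N choose i)" using T by (simp add: card_nsets)
    finally have "real (card (L \<inter> H)) \<le> real (\<Sum>i\<in>{N + 1 - t..<t}. N choose i)" by (rule of_nat_mono)
    also have "\<dots> = (\<Sum>i\<in>{N + 1 - t..<t}. real (N choose i))" by (rule of_nat_sum)
    also have "\<dots> \<le> (\<Sum>i\<in>{N + 1 - t..<t}. 2 ^ N / sqrt N)"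
      using binomial_le_sqrt N(2) by (intro sum_mono) (simp add: pos_le_divide_eq)
    also have "\<dots> = real (t - (N + 1 - t)) * (2 ^ N / sqrt N)" by simp
    also have "\<dots> \<le> real s * (2 ^ N / sqrt N)"
      using t by (intro mult_right_mono) auto
    finally show ?thesis .
  qed
  moreover have "real s * (2 ^ N / sqrt N) \<le> 2 ^ N / 2"
  proof -
    have "real (4 * s\<^sup>2) \<le> real N" using N(1) by (rule of_nat_mono)
    then have "2 * real s \<le> sqrt N" by (intro real_le_rsqrt) (simp add: power_mult_distrib)
    then have "real s / sqrt N \<le> 1 / 2" using N(2) by (simp add: divide_simps)
    then have "real s / sqrt N * 2 ^ N \<le> 1 / 2 * 2 ^ N" by (intro mult_right_mono) auto
    then show ?thesis by simp
  qed
  ultimately show ?thesis unfolding L_def by linarith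
qed

section \<open>Graphs of small maximum degree\<close>

lemma card_neighbours_le_degree:
  assumes "finite E"
  shows "card {u \<in> T. {v, u} \<in> E} \<le> degree E v"
proof -
  have "inj_on (\<lambda>u. {v, u}) {u \<in> T. {v, u} \<in> E}" by (auto simp: inj_on_def doubleton_eq_iff)
  then show ?thesis
    unfolding degree_def by (rule card_inj_on_le) (use assms in auto)
qed

text \<open>A graph is determined by its edges outside \<open>S \<times> T\<close> and by the
  neighbourhoods in \<open>T\<close> of the vertices of \<open>S\<close>; low degrees force each of
  these neighbourhoods below size \<open>t\<close>. Thus the probability of low degrees is at most
  the \<open>card S\<close>-th power of that for one random subset of \<open>T\<close>, written here
  without division.\<close>

lemma card_low_degree_graphs_le:
  assumes V: "finite V" "S \<subseteq> V" "T \<subseteq> V" "S \<inter> T = {}"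
  shows "card {E. E \<subseteq> nsets V 2 \<and> (\<forall>v\<in>V. degree E v < t)} * 2 ^ (card S * card T)
    \<le> 2 ^ card (nsets V 2) * card {R. R \<subseteq> T \<and> card R < t} ^ card S"
proof -
  define U where "U = nsets V 2"
  define X where "X = cross_edges S T"
  define \<R> where "\<R> = {R. R \<subseteq> T \<and> card R < t}"
  define \<G> where "\<G> = {E. E \<subseteq> U \<and> (\<forall>v\<in>V. degree E v < t)}"
  define \<phi> where "\<phi> E = (E - X, \<lambda>v\<in>S. {u \<in> T. {v, u} \<in> E})" for E
  have fin: "finite U" "finite S" "finite T"
    using V by (auto simp: U_def finite_imp_finite_nsets intro: finite_subset)
  have X: "X \<subseteq> U" "card X = card S * card T"
    using cross_edges_subset card_cross_edges V by (auto simp: X_def U_def)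
  have "inj_on \<phi> \<G>"
  proof (rule inj_onI)
    fix E E' assume eq: "\<phi> E = \<phi> E'"
    have "{v, u} \<in> E \<longleftrightarrow> {v, u} \<in> E'" if "v \<in> S" "u \<in> T" for u v
      using fun_cong[OF arg_cong[OF eq, of snd], of v] that by (auto simp: \<phi>_def)
    then have "E \<inter> X = E' \<inter> X" by (auto simp: X_def cross_edges_def)
    moreover have "E - X = E' - X" using eq by (simp add: \<phi>_def)
    ultimately show "E = E'" by blast
  qed
  moreover have "\<phi> ` \<G> \<subseteq> Pow (U - X) \<times> (S \<rightarrow>\<^sub>E \<R>)"
  proof (rule image_subsetI)
    fix E assume E: "E \<in> \<G>"
    then have finE: "finite E" using fin(1) by (auto simp: \<G>_def intro: finite_subset)
    have "(\<lambda>v\<in>S. {u \<in> T. {v, u} \<in> E}) \<in> S \<rightarrow>\<^sub>E \<R>"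
    proof (rule restrict_PiE_iff[THEN iffD2], rule ballI)
      fix v assume v: "v \<in> S"
      then have "card {u \<in> T. {v, u} \<in> E} < t"
        using card_neighbours_le_degree[OF finE, of T v] E V(2) by (fastforce simp: \<G>_def)
      then show "{u \<in> T. {v, u} \<in> E} \<in> \<R>" by (auto simp: \<R>_def)
    qed
    then show "\<phi> E \<in> Pow (U - X) \<times> (S \<rightarrow>\<^sub>E \<R>)" using E by (auto simp: \<phi>_def \<G>_def)
  qed
  moreover have "finite (Pow (U - X) \<times> (S \<rightarrow>\<^sub>E \<R>))"
    using fin by (auto simp: \<R>_def intro!: finite_PiE)
  ultimately have "card \<G> \<le> card (Pow (U - X) \<times> (S \<rightarrow>\<^sub>E \<R>))" by (rule card_inj_on_le)
  also have "\<dots> = 2 ^ (card U - card X) * card \<R> ^ card S"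
    using fin X(1) by (simp add: card_cartesian_product card_Pow card_PiE card_Diff_subset finite_subset)
  finally have "card \<G> * 2 ^ card X \<le> 2 ^ (card U - card X) * card \<R> ^ card S * 2 ^ card X" by simp
  also have "\<dots> = 2 ^ card U * card \<R> ^ card S"
    using card_mono[OF fin(1) X(1)] by (simp add: mult_ac flip: power_add)
  finally show ?thesis unfolding \<G>_def U_def \<R>_def X(2) .
qed

lemma graph_fraction_low_degree_le:
  assumes n: "4 * s\<^sup>2 + 2 * s + 1 \<le> n"
  shows "graph_fraction (\<lambda>E. \<forall>v\<in>{1..n}. degree E v < n div 2) n \<le> (3 / 4) ^ s"
proof -
  let ?S = "{1..s}" and ?T = "{s + 1..n}" and ?t = "n div 2"
  define g where "g = card {E. E \<subseteq> nsets {1..n} 2 \<and> (\<forall>v\<in>{1..n}. degree E v < ?t)}"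
  define r where "r = card {R. R \<subseteq> ?T \<and> card R < ?t}"
  have r: "real r \<le> 3 / 4 * 2 ^ (n - s)"
    \<comment> \<open>Here \<open>N = n - s\<close> and \<open>t = n div 2\<close>, so
      \<open>2 * t \<le> n = N + s\<close>; the bound on \<open>n\<close> supplies
      \<open>4 * s\<^sup>2 \<le> N\<close>.\<close>
    unfolding r_def by (rule card_small_subsets_le[where s = s]) (use n in auto)
  have "g * 2 ^ (s * (n - s)) \<le> 2 ^ (n choose 2) * r ^ s"
    using card_low_degree_graphs_le[of "{1..n}" ?S ?T ?t] n
    by (auto simp: g_def r_def card_nsets)
  from of_nat_mono[OF this, where 'a = real]
  have "real g * 2 ^ (s * (n - s)) \<le> 2 ^ (n choose 2) * real r ^ s" by simp
  also have "\<dots> \<le> 2 ^ (n choose 2) * (3 / 4 * 2 ^ (n - s)) ^ s"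
    using r by (intro mult_left_mono power_mono) auto
  also have "(3 / 4 * 2 ^ (n - s)) ^ s = (3 / 4 :: real) ^ s * 2 ^ (s * (n - s))"
    unfolding power_mult_distrib power_mult[symmetric] mult.commute[of s] ..
  finally have "real g * 2 ^ (s * (n - s)) \<le> (2 ^ (n choose 2) * (3 / 4) ^ s) * 2 ^ (s * (n - s))"
    by (simp only: mult.assoc)
  then have "real g \<le> 2 ^ (n choose 2) * (3 / 4) ^ s" by (rule mult_right_le_imp_le) simp
  then show ?thesis by (simp add: graph_fraction_def g_def pos_divide_le_eq mult.commute)
qed

lemma graph_fraction_low_degree_tendsto_0:
  "(\<lambda>n. graph_fraction (\<lambda>E. \<forall>v\<in>{1..n}. degree E v < n div 2) n) \<longlonglongrightarrow> 0"
proof (rule order_tendstoI)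
  fix \<epsilon> :: real assume "0 < \<epsilon>"
  \<comment> \<open>The number \<open>s\<close> of test vertices depends on
    \<open>\<epsilon>\<close> only and stays fixed while \<open>n\<close> grows.\<close>
  then obtain s where s: "(3 / 4) ^ s < \<epsilon>" using real_arch_pow_inv[of \<epsilon> "3 / 4"] by auto
  show "\<forall>\<^sub>F n in sequentially. graph_fraction (\<lambda>E. \<forall>v\<in>{1..n}. degree E v < n div 2) n < \<epsilon>"
    using eventually_ge_at_top[of "4 * s\<^sup>2 + 2 * s + 1"]
    by eventually_elim (use graph_fraction_low_degree_le s in fastforce)
next
  fix \<epsilon> :: real assume "\<epsilon> < 0"
  then show "\<forall>\<^sub>F n in sequentially. \<epsilon> < graph_fraction (\<lambda>E. \<forall>v\<in>{1..n}. degree E v < n div 2) n"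
    by (intro always_eventually allI) (rule less_le_trans[OF _ graph_fraction_nonneg])
qed

theorem theorem2p6:
  shows "almost_all_graphs (\<lambda>V E.
    \<forall>(w :: nat set \<Rightarrow> real) (k :: nat).
      weight_function E w \<longrightarrow> 0 < k \<longrightarrow> max_degree V E \<le> k \<longrightarrow>
        (\<exists>X Y. bisection V X Y \<and>
          (odd k \<longrightarrow>
             cut_weight E w X Y \<ge> (real k + 1) / (2 * real k) * total_weight E w) \<and>
          (even k \<longrightarrow>
             cut_weight E w X Y \<ge> (real k + 2) / (2 * (real k + 1)) * total_weight E w)))"
    (is "almost_all_graphs ?P")
proof (rule almost_all_graphsI)
  \<comment> \<open>The three exceptional events: a large star, a balanced biclique, and all degrees
    below \<open>n div 2\<close>.\<close>
  define Q1 where "Q1 n E \<longleftrightarrow> has_biclique {1..n} E 1 (n - 2 * floor_sqrt n)" for n E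
  define Q2 where "Q2 n E \<longleftrightarrow> has_biclique {1..n} E (floor_sqrt n) (floor_sqrt n)" for n E
  define Q3 where "Q3 n E \<longleftrightarrow> (\<forall>v\<in>{1..n}. degree E v < n div 2)" for n and E :: "nat set set"
  show "(\<lambda>n. graph_fraction (\<lambda>E. \<not> ?P {1..n} E) n) \<longlonglongrightarrow> 0"
  proof (rule tendsto_sandwich[where f = "\<lambda>_. 0"])
    show "\<forall>\<^sub>F n in sequentially. graph_fraction (\<lambda>E. \<not> ?P {1..n} E) n
        \<le> graph_fraction (Q1 n) n + (graph_fraction (Q2 n) n + graph_fraction (Q3 n) n)"
      \<comment> \<open>From 5 on, \<open>2 * sqrt n < n\<close> is strict, so the star excluded by
        \<open>Q1\<close> has at least one leaf, as \<open>bisection_bound\<close> requires.\<close>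
      using eventually_ge_at_top[of 5]
    proof eventually_elim
      case (elim n)
      have q0: "0 < floor_sqrt n" using elim by simp
      have "2 * sqrt n < sqrt n * sqrt n"
        using elim by (intro mult_strict_right_mono) (auto intro: real_less_rsqrt)
      then have qn: "2 * floor_sqrt n < n" using floor_sqrt_bounds(1)[of n] by simp
      have "?P {1..n} E" if E: "E \<subseteq> nsets {1..n} 2" and Q: "\<not> Q1 n E" "\<not> Q2 n E" "\<not> Q3 n E" for E
      proof (intro allI impI)
        fix w :: "nat set \<Rightarrow> real" and k
        assume w: "weight_function E w" and k: "max_degree {1..n} E \<le> k"
        \<comment> \<open>A single vertex of degree at least \<open>n div 2\<close> forces
          \<open>n div 2 \<le> k\<close>, for every admissible \<open>k\<close> at once.\<close>
        obtain v where v: "v \<in> {1..n}" "n div 2 \<le> degree E v"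
          using Q(3) by (auto simp: Q3_def not_less)
        have "degree E v \<le> max_degree {1..n} E"
          unfolding max_degree_def using v(1) by (intro Max_ge) auto
        then have "n div 2 \<le> k" using v k by linarith
        from bisection_bound[OF E w q0 qn _ _ this] Q
        show "\<exists>X Y. bisection {1..n} X Y \<and>
          (odd k \<longrightarrow> cut_weight E w X Y \<ge> (real k + 1) / (2 * real k) * total_weight E w) \<and>
          (even k \<longrightarrow> cut_weight E w X Y \<ge> (real k + 2) / (2 * (real k + 1)) * total_weight E w)"
          unfolding Q1_def Q2_def by metis
      qed
      then have "graph_fraction (\<lambda>E. \<not> ?P {1..n} E) n
          \<le> graph_fraction (Q1 n) n + graph_fraction (\<lambda>E. Q2 n E \<or> Q3 n E) n"
        by (intro graph_fraction_subadd) blast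
      also have "graph_fraction (\<lambda>E. Q2 n E \<or> Q3 n E) n
          \<le> graph_fraction (Q2 n) n + graph_fraction (Q3 n) n"
        by (rule graph_fraction_subadd)
      finally show ?case by simp
    qed
    have "(\<lambda>n. graph_fraction (Q1 n) n + (graph_fraction (Q2 n) n + graph_fraction (Q3 n) n))
        \<longlonglongrightarrow> 0 + (0 + 0)"
      unfolding Q1_def Q2_def Q3_def
      by (intro tendsto_add graph_fraction_star_tendsto_0 graph_fraction_biclique_tendsto_0
          graph_fraction_low_degree_tendsto_0)
    then show "(\<lambda>n. graph_fraction (Q1 n) n + (graph_fraction (Q2 n) n + graph_fraction (Q3 n) n))
        \<longlonglongrightarrow> 0" by simp
  qed (auto simp: graph_fraction_nonneg)
qed

end
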